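(* Let $C\subseteq\mathbb{R}^{n+1}$ be a proper open cone with base-point $b\in C$. Let $x,y\in\partial C\setminus\{0\}$, $S\in\mathcal{T}(\tau(C,x))$, $T\in\mathcal{T}(\tau(C,y))$, $p\in S$, $q\in T$, and suppose that $g=r_{C,x}+f_{S,p}|_C$ and $h=r_{C,y}+f_{T,q}|_C$ are Busemann points of the Hilbert geometry on $C$. Then \[\delta(g,h)=\begin{cases} d_F(x,y)+d_S(p,q) & \text{if $x$ and $y$ have the same face $F$, and $S=T$,}\\ \infty & \text{otherwise.}\end{cases}\]
   Context: An open cone $C\subseteq\mathbb{R}^{n+1}$ is a nonempty open convex set with $\lambda C\subseteq C$ for all $\lambda>0$; it is proper if $\overline C\cap(-\overline C)=\{0\}$. For a convex cone $K$ (e.g. an open cone, or a face of $\overline C$) and $x,y$ with $x$ in the relative interior of $K$, let $M(y/x;K)=\inf\{\lambda>0\colon \lambda x-y\in\overline K\}$. Funk metric: $\mathcal F_K(x,y)=\log M(x/y;K)$; reverse-Funk metric: $\mathcal{RF}_K(x,y)=\log M(y/x;K)$; Hilbert's projective metric $d_K(x,y)=\mathcal F_K(x,y)+\mathcal{RF}_K(x,y)$ (for $x,y$ in the relative interior of $K$). For $z\in\partial C$ the open tangent cone is $\tau(C,z)=\{\lambda(w-z)\colon \lambda>0,\ w\in C\}$. For a collection $\Pi$ of open cones let $\Gamma(\Pi)=\{\tau(T,z)\colon T\in\Pi,\ z\in\partial T\}$, and $\mathcal T(C)=\bigcup_{k=1}^{n}\Gamma^k(\{C\})$ (each cone in $\mathcal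 T(C)$ contains $C$). For an open cone $T\supseteq C$ and $p\in T$, $f_{T,p}(w)=\mathcal F_T(w,p)-\mathcal F_T(b,p)$; for $z\in\overline C$, $r_{C,z}(w)=\mathcal{RF}_C(w,z)-\mathcal{RF}_C(b,z)$ for $w\in C$. The face of $x\in\overline C$ is the set of $y\in\overline C$ such that the line through $x$ and $y$ contains an open segment $I\subseteq\overline C$ with $x\in I$; $d_F$ is Hilbert's projective metric of this face $F$ (a convex cone) on its relative interior. Horofunctions of the Hilbert geometry on $C$: for $z\in C$ let $\phi_z(w)=d_C(w,z)-d_C(b,z)$, $w\in C$; give functions on $C$ the topology of uniform convergence on compact sets. A path $\gamma\colon T_0\to C$ ($T_0\subseteq\mathbb{R}$ unbounded, $0\in T_0$) is an almost-geodesic if for every $\epsilon>0$ there is $M$ with $|d_C(\gamma(0),\gamma(s))+d_C(\gamma(s),\gamma(t))-t|<\epsilon$ for all $s,t\in T_0$, $t\geq s\geq M$. A Busemann point is a limit $\xi=\lim_{t\to\infty}\phi_{\gamma(t)}$ along an almost-geodesic $\gamma$, not itself of the form $\phi_z$ up to this topology. The detour cost of Busemann points $\xi,\eta$ is $H(\xi,\eta)=\inf_\gamma\liminf_{t\to\infty}\big(d_C(b,\gamma(t))+\eta(\gamma(t))\big)$, the infimum over all paths $\gamma$ with $\phi_{\gamma(t)}\to\xi$, and the detour metric is $\delta(\xi,\eta)=H(\xi,\eta)+H(\eta,\xi)$. *)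

theory Defs
  imports "HOL-Analysis.Analysis"
begin

definition open_cone :: "'a::euclidean_space set \<Rightarrow> bool" where
  "open_cone C \<longleftrightarrow> C \<noteq> {} \<and> open C \<and> convex C \<and> (\<forall>l>0. \<forall>x\<in>C. l *\<^sub>R x \<in> C)"

definition proper_cone :: "'a::euclidean_space set \<Rightarrow> bool" where
  "proper_cone C \<longleftrightarrow> open_cone C \<and> closure C \<inter> uminus ` closure C = {0}"

definition Mcone :: "'a::euclidean_space set \<Rightarrow> 'a \<Rightarrow> 'a \<Rightarrow> real" where
  "Mcone K y x = Inf {l. l > 0 \<and> l *\<^sub>R x - y \<in> closure K}"

definition funk :: "'a::euclidean_space set \<Rightarrow> 'a \<Rightarrow> 'a \<Rightarrow> real" where
  "funk K x y = ln (Mcone K x y)"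

definition rfunk :: "'a::euclidean_space set \<Rightarrow> 'a \<Rightarrow> 'a \<Rightarrow> real" where
  "rfunk K x y = ln (Mcone K y x)"

definition hilbert :: "'a::euclidean_space set \<Rightarrow> 'a \<Rightarrow> 'a \<Rightarrow> real" where
  "hilbert K x y = funk K x y + rfunk K x y"

definition tangent_cone :: "'a::euclidean_space set \<Rightarrow> 'a \<Rightarrow> 'a set" where
  "tangent_cone C z = {l *\<^sub>R (w - z) | l w. l > 0 \<and> w \<in> C}"

definition Gamma :: "'a::euclidean_space set set \<Rightarrow> 'a set set" where
  "Gamma P = {tangent_cone T z | T z. T \<in> P \<and> z \<in> frontier T}"

text \<open>The collection T(C); here n = DIM('a) - 1.\<close>
definition cone_tangents :: "'a::euclidean_space set \<Rightarrow> 'a set set" where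
  "cone_tangents C = (\<Union>k\<in>{1..DIM('a) - 1}. (Gamma ^^ k) {C})"

definition funk_horo :: "'a::euclidean_space set \<Rightarrow> 'a \<Rightarrow> 'a \<Rightarrow> 'a \<Rightarrow> real" where
  "funk_horo T b p w = funk T w p - funk T b p"

definition rfunk_horo :: "'a::euclidean_space set \<Rightarrow> 'a \<Rightarrow> 'a \<Rightarrow> 'a \<Rightarrow> real" where
  "rfunk_horo C b z w = rfunk C w z - rfunk C b z"

definition cone_face :: "'a::euclidean_space set \<Rightarrow> 'a \<Rightarrow> 'a set" where
  "cone_face C x = {y \<in> closure C. \<exists>a c. a \<noteq> c \<and> open_segment a c \<subseteq> closure C \<and>
      x \<in> open_segment a c \<and> collinear {x, y, a, c}}"

definition horo :: "'a::euclidean_space set \<Rightarrow> 'a \<Rightarrow> 'a \<Rightarrow> 'a \<Rightarrow> real" where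
  "horo C b z w = hilbert C w z - hilbert C b z"

definition ucc_tendsto :: "'a::euclidean_space set \<Rightarrow> ('b \<Rightarrow> 'a \<Rightarrow> real) \<Rightarrow> ('a \<Rightarrow> real) \<Rightarrow> 'b filter \<Rightarrow> bool" where
  "ucc_tendsto C \<Phi> \<xi> F \<longleftrightarrow> (\<forall>K. compact K \<and> K \<subseteq> C \<longrightarrow>
      (\<forall>e>0. eventually (\<lambda>t. \<forall>w\<in>K. \<bar>\<Phi> t w - \<xi> w\<bar> < e) F))"

definition path_filter :: "real set \<Rightarrow> real filter" where
  "path_filter T0 = inf at_top (principal T0)"

definition is_path :: "'a::euclidean_space set \<Rightarrow> real set \<Rightarrow> (real \<Rightarrow> 'a) \<Rightarrow> bool" where
  "is_path C T0 \<gamma> \<longleftrightarrow> (\<forall>M. \<exists>t\<in>T0. t \<ge> M) \<and> 0 \<in> T0 \<and> \<gamma> ` T0 \<subseteq> C"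

definition almost_geodesic :: "'a::euclidean_space set \<Rightarrow> real set \<Rightarrow> (real \<Rightarrow> 'a) \<Rightarrow> bool" where
  "almost_geodesic C T0 \<gamma> \<longleftrightarrow> is_path C T0 \<gamma> \<and>
     (\<forall>e>0. \<exists>M. \<forall>s\<in>T0. \<forall>t\<in>T0. M \<le> s \<and> s \<le> t \<longrightarrow>
        \<bar>hilbert C (\<gamma> 0) (\<gamma> s) + hilbert C (\<gamma> s) (\<gamma> t) - t\<bar> < e)"

definition busemann :: "'a::euclidean_space set \<Rightarrow> 'a \<Rightarrow> ('a \<Rightarrow> real) \<Rightarrow> bool" where
  "busemann C b \<xi> \<longleftrightarrow>
     (\<exists>T0 \<gamma>. almost_geodesic C T0 \<gamma> \<and> ucc_tendsto C (\<lambda>t. horo C b (\<gamma> t)) \<xi> (path_filter T0)) \<and>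
     \<not> (\<exists>z\<in>C. \<forall>w\<in>C. \<xi> w = horo C b z w)"

definition detour_cost :: "'a::euclidean_space set \<Rightarrow> 'a \<Rightarrow> ('a \<Rightarrow> real) \<Rightarrow> ('a \<Rightarrow> real) \<Rightarrow> ereal" where
  "detour_cost C b \<xi> \<eta> = Inf {Liminf (path_filter T0) (\<lambda>t. ereal (hilbert C b (\<gamma> t) + \<eta> (\<gamma> t))) | T0 \<gamma>.
      is_path C T0 \<gamma> \<and> ucc_tendsto C (\<lambda>t. horo C b (\<gamma> t)) \<xi> (path_filter T0)}"

definition detour_metric :: "'a::euclidean_space set \<Rightarrow> 'a \<Rightarrow> ('a \<Rightarrow> real) \<Rightarrow> ('a \<Rightarrow> real) \<Rightarrow> ereal" where
  "detour_metric C b \<xi> \<eta> = detour_cost C b \<xi> \<eta> + detour_cost C b \<eta> \<xi>"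

end

(* Along an almost-geodesic gamma converging to g one has d(u, gamma) + g(gamma) -> g(u) for every
   u, so H(g,h) is the supremum of h - g over C. Since d is the sum of the Funk and the reverse-Funk
   metric, and each of them satisfies its own triangle inequality, both parts of this limit hold
   separately; hence the supremum of h - g is the sum of the suprema of r_y - r_x and of
   f_{T,q} - f_{S,p}. The first is log M(y/x;C) up to the base-point constant, as one sees by letting
   the argument tend to x, and it is finite iff y lies in the face of x. The second, when finite,
   forces S to be contained in T, and it is then log M(p/q;T) up to a constant. The constants cancel
   in H(g,h) + H(h,g). *)

theory Submission
  imports Defs
begin

section \<open>Arithmetic in the closure of an open cone\<close>

lemma closure_open_cone_scaleR:
  assumes "open_cone K" "x \<in> closure K" "0 \<le> l"
  shows "l *\<^sub>R x \<in> closure K"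
proof -
  obtain f where f: "\<And>n. f n \<in> K" "f \<longlonglongrightarrow> x"
    using assms(2) closure_sequential by blast
  have *: "l *\<^sub>R x \<in> closure K" if "l > 0" for l
  proof -
    have "(\<lambda>n. l *\<^sub>R f n) \<longlonglongrightarrow> l *\<^sub>R x"
      by (intro tendsto_intros f)
    moreover have "\<And>n. l *\<^sub>R f n \<in> K"
      using assms(1) f(1) that by (auto simp: open_cone_def)
    ultimately show ?thesis unfolding closure_sequential by (intro exI conjI allI)
  qed
  have "(\<lambda>n. inverse (real (Suc n)) *\<^sub>R x) \<longlonglongrightarrow> 0 *\<^sub>R x"
    by (intro tendsto_intros LIMSEQ_inverse_real_of_nat)
  then have "0 *\<^sub>R x \<in> closure K"
    by (rule closed_sequentially[OF closed_closure, rotated]) (simp add: *)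
  with * assms(3) show ?thesis
    by (cases "l = 0") auto
qed

lemma closure_open_cone_add:
  assumes "open_cone K" "x \<in> closure K" "y \<in> closure K"
  shows "x + y \<in> closure K"
proof -
  have "convex (closure K)"
    using assms(1) by (auto simp: open_cone_def convex_closure)
  then have "(1/2) *\<^sub>R x + (1/2) *\<^sub>R y \<in> closure K"
    using assms by (auto intro: convexD)
  then have "2 *\<^sub>R ((1/2) *\<^sub>R x + (1/2) *\<^sub>R y) \<in> closure K"
    using closure_open_cone_scaleR[OF assms(1)] by force
  then show ?thesis by (simp add: scaleR_add_right)
qed

text \<open>On a segment from an interior point of a convex set to a point of its closure, only the
  second endpoint can fail to be interior. The midpoint therefore lies in \<open>K\<close>, and
  doubling it gives the sum.\<close>

lemma open_cone_add_closure:
  assumes "open_cone K" "x \<in> K" "y \<in> closure K"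
  shows "x + y \<in> K"
proof -
  have K: "open K" "convex K" "\<And>l x. l > 0 \<Longrightarrow> x \<in> K \<Longrightarrow> l *\<^sub>R x \<in> K"
    using assms(1) by (auto simp: open_cone_def)
  have "(1/2) *\<^sub>R (x + y) \<in> K"
  proof (cases "x = y")
    case True
    then show ?thesis using assms by (simp flip: scaleR_2)
  next
    case False
    then have "(1/2) *\<^sub>R (x + y) \<in> open_segment x y"
      using midpoint_in_open_segment[of x y] by (simp add: midpoint_def)
    then show ?thesis
      using in_interior_closure_convex_segment[of K x y] K assms by (auto simp: interior_open)
  qed
  from K(3)[OF _ this, of 2] show ?thesis by simp
qed

text \<open>Openness keeps \<open>a - e *\<^sub>R y\<close> in \<open>K\<close> for small
  \<open>e\<close>; rescaling by \<open>1/e\<close> gives the claim. It shows that the sets whose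
  infimum defines \<open>Mcone\<close> are nonempty when the reference point lies in the
  cone.\<close>

lemma open_cone_dominates:
  assumes "open_cone K" "a \<in> K"
  shows "\<exists>l. l *\<^sub>R a - y \<in> closure K"
proof -
  have "((\<lambda>e. a - e *\<^sub>R y) \<longlongrightarrow> a - 0 *\<^sub>R y) (at_right 0)"
    by (intro tendsto_intros)
  then have "\<forall>\<^sub>F e in at_right 0. a - e *\<^sub>R y \<in> K"
    using assms by (intro topological_tendstoD) (auto simp: open_cone_def)
  then have "\<forall>\<^sub>F e::real in at_right 0. a - e *\<^sub>R y \<in> K \<and> e > 0"
    using eventually_at_right_less by (rule eventually_conj)
  then obtain e :: real where e: "a - e *\<^sub>R y \<in> K" "e > 0"
    using eventually_happens' trivial_limit_at_right_real by blast
  then have "(1/e) *\<^sub>R (a - e *\<^sub>R y) \<in> closure K"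
    using closure_open_cone_scaleR[OF assms(1)] closure_subset by fastforce
  then have "(1/e) *\<^sub>R a - y \<in> closure K"
    using e by (simp add: scaleR_diff_right)
  then show ?thesis ..
qed

lemma open_cone_uminus_notin_closure:
  assumes "open_cone K" "0 \<notin> K" "x \<in> K"
  shows "- x \<notin> closure K"
  using open_cone_add_closure[OF assms(1,3), of "- x"] assms(2) by auto

section \<open>The gauge \<open>Mcone\<close> as an attained infimum, and its multiplicative
  triangle inequality\<close>

text \<open>The admissible \<open>l\<close> form a closed upward-closed set. Since
  \<open>- y\<close> is outside the closure, this set contains no \<open>l \<le> 0\<close>, so the
  positivity constraint in the definition is automatic and the infimum is attained. The point
  \<open>a\<close> may lie on the boundary; \<open>l0\<close> then witnesses that some multiple of
  it dominates \<open>y\<close>.\<close>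

lemma
  assumes K: "open_cone K" "a \<in> closure K" "- y \<notin> closure K" "l0 *\<^sub>R a - y \<in> closure K"
  shows Mcone_le_iff: "Mcone K y a \<le> l \<longleftrightarrow> l *\<^sub>R a - y \<in> closure K"
    and Mcone_pos: "0 < Mcone K y a"
proof -
  let ?L = "{l. l > 0 \<and> l *\<^sub>R a - y \<in> closure K}"
  have up: "l' *\<^sub>R a - y \<in> closure K" if "l \<le> l'" "l *\<^sub>R a - y \<in> closure K" for l l'
  proof -
    have "(l *\<^sub>R a - y) + (l' - l) *\<^sub>R a \<in> closure K"
      using that by (intro closure_open_cone_add closure_open_cone_scaleR K) auto
    then show ?thesis by (simp add: algebra_simps)
  qed
  \<comment> \<open>An admissible \<open>l \<le> 0\<close> would make \<open>0\<close> admissible as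
    well, which puts \<open>- y\<close> into the closure.\<close>
  have pos: "l > 0" if "l *\<^sub>R a - y \<in> closure K" for l
    using up[of l 0] that K(3) by force
  have L: "?L = {l. l *\<^sub>R a - y \<in> closure K}"
    using pos by auto
  have "closed {l. l *\<^sub>R a - y \<in> closure K}"
    unfolding vimage_def[of "\<lambda>l. l *\<^sub>R a - y" "closure K", symmetric]
    by (intro closed_vimage closed_closure continuous_intros)
  then have "closed ?L" using L by simp
  moreover have bd: "bdd_below ?L"
    by (rule bdd_belowI[of _ 0]) simp
  moreover have "?L \<noteq> {}" unfolding L using K(4) by blast
  ultimately have "Inf ?L \<in> ?L"
    by (intro closed_contains_Inf)
  then have *: "Mcone K y a *\<^sub>R a - y \<in> closure K"
    by (auto simp: Mcone_def)
  from pos[OF *] show "0 < Mcone K y a" .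
  show "Mcone K y a \<le> l \<longleftrightarrow> l *\<^sub>R a - y \<in> closure K"
  proof
    assume "l *\<^sub>R a - y \<in> closure K"
    then have "l \<in> ?L" using pos by auto
    then show "Mcone K y a \<le> l"
      unfolding Mcone_def using bd by (rule cInf_lower)
  qed (use up * in blast)
qed

text \<open>Both infima are attained, so the two optimal membership relations can be added after
  scaling one of them. Boundary points are allowed for \<open>y\<close> and \<open>z\<close> as long
  as the dominations exist.\<close>

lemma Mcone_triangle:
  assumes K: "open_cone K" and z: "z \<in> closure K" and y: "y \<in> closure K"
    and xy: "- x \<notin> closure K" "- y \<notin> closure K"
    and "l *\<^sub>R y - x \<in> closure K" "m *\<^sub>R z - y \<in> closure K"
  shows "Mcone K x z \<le> Mcone K x y * Mcone K y z"
proof -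
  let ?M = "Mcone K x y" and ?N = "Mcone K y z"
  have M: "?M > 0" "?M *\<^sub>R y - x \<in> closure K"
    using Mcone_pos[OF K y xy(1) assms(6)] Mcone_le_iff[OF K y xy(1) assms(6), of ?M] by auto
  have N: "?N *\<^sub>R z - y \<in> closure K"
    using Mcone_le_iff[OF K z xy(2) assms(7), of ?N] by auto
  have "?M *\<^sub>R (?N *\<^sub>R z - y) + (?M *\<^sub>R y - x) \<in> closure K"
    using M N by (intro closure_open_cone_add closure_open_cone_scaleR K) auto
  then have "(?M * ?N) *\<^sub>R z - x \<in> closure K"
    by (simp add: algebra_simps)
  then show ?thesis
    using Mcone_le_iff[OF K z xy(1)] by blast
qed

lemma
  assumes K: "open_cone K" "0 \<notin> K" "p \<in> K" "w \<in> K"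
  shows Mcone_le_iff_open: "Mcone K w p \<le> l \<longleftrightarrow> l *\<^sub>R p - w \<in> closure K"
    and Mcone_pos_open: "0 < Mcone K w p"
proof -
  obtain m where "m *\<^sub>R p - w \<in> closure K"
    using open_cone_dominates[OF K(1,3)] by blast
  note m = K(1) closure_subset[THEN subsetD, OF K(3)] open_cone_uminus_notin_closure[OF K(1,2,4)] this
  show "Mcone K w p \<le> l \<longleftrightarrow> l *\<^sub>R p - w \<in> closure K" "0 < Mcone K w p"
    using Mcone_le_iff[OF m] Mcone_pos[OF m] by auto
qed

lemma Mcone_triangle_open:
  assumes K: "open_cone K" "0 \<notin> K" and "x \<in> K" "y \<in> K" "z \<in> K"
  shows "Mcone K x z \<le> Mcone K x y * Mcone K y z"
proof -
  obtain l m where lm: "l *\<^sub>R y - x \<in> closure K" "m *\<^sub>R z - y \<in> closure K"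
    using open_cone_dominates[OF K(1)] assms(4,5) by meson
  show ?thesis
    by (rule Mcone_triangle[OF K(1) closure_subset[THEN subsetD, OF assms(5)]
          closure_subset[THEN subsetD, OF assms(4)] open_cone_uminus_notin_closure[OF K assms(3)]
          open_cone_uminus_notin_closure[OF K assms(4)] lm])
qed

text \<open>A value below 1 would make a negative multiple of \<open>w\<close> lie in the closure,
  hence \<open>- w\<close> too.\<close>

lemma Mcone_refl:
  assumes "open_cone K" "0 \<notin> K" "w \<in> K"
  shows "Mcone K w w = 1"
proof (rule antisym)
  have 0: "0 \<in> closure K"
    using closure_open_cone_scaleR[OF assms(1), of w 0] assms closure_subset by auto
  then show "Mcone K w w \<le> 1"
    using Mcone_le_iff_open[OF assms(1,2,3,3)] by simp
  show "1 \<le> Mcone K w w"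
  proof (rule ccontr)
    let ?M = "Mcone K w w"
    assume M: "\<not> 1 \<le> ?M"
    have "(?M - 1) *\<^sub>R w \<in> closure K"
      using Mcone_le_iff_open[OF assms(1,2,3,3), of ?M] by (simp add: algebra_simps)
    then have "(1 / (1 - ?M)) *\<^sub>R ((?M - 1) *\<^sub>R w) \<in> closure K"
      using M by (intro closure_open_cone_scaleR[OF assms(1), of "(?M - 1) *\<^sub>R w"]) auto
    moreover have "(1 / (1 - ?M)) * (?M - 1) = -1"
      using M by (simp add: field_simps)
    ultimately have "- w \<in> closure K" by simp
    then show False using open_cone_uminus_notin_closure[OF assms] by simp
  qed
qed

lemma Mcone_antimono:
  assumes "open_cone K" "0 \<notin> K" "open_cone T" "0 \<notin> T" "K \<subseteq> T" "w \<in> K" "v \<in> K"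
  shows "Mcone T w v \<le> Mcone K w v"
proof -
  have "Mcone K w v *\<^sub>R v - w \<in> closure T"
    using Mcone_le_iff_open[OF assms(1,2,7,6), of "Mcone K w v"] closure_mono[OF assms(5)] by auto
  then show ?thesis using Mcone_le_iff_open[OF assms(3,4)] assms by blast
qed

section \<open>Proper cones and the triangle inequalities of the Funk and reverse-Funk
  metrics\<close>

text \<open>An open cone containing 0 absorbs every vector, so its closure would be the whole space;
  a basis vector then contradicts properness.\<close>

lemma proper_cone_zero_notin:
  fixes C :: "'a::euclidean_space set"
  assumes "proper_cone C" shows "0 \<notin> C"
proof
  assume "0 \<in> C"
  have C: "open_cone C" using assms by (simp add: proper_cone_def)
  obtain v :: 'a where v: "v \<in> Basis" using nonempty_Basis by blast
  have "- u \<in> closure C" for u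
    using open_cone_dominates[OF C \<open>0 \<in> C\<close>, of u] by auto
  from this[of v] this[of "- v"] have "v \<in> closure C \<inter> uminus ` closure C"
    using image_eqI[of v uminus "- v" "closure C"] by simp
  then have "v = 0" using assms by (auto simp: proper_cone_def)
  then show False using v by auto
qed

lemma proper_cone_uminus_notin:
  assumes "proper_cone C" "z \<in> closure C" "z \<noteq> 0" shows "- z \<notin> closure C"
proof
  assume "- z \<in> closure C"
  then have "z \<in> closure C \<inter> uminus ` closure C"
    using assms image_eqI[of z uminus "- z" "closure C"] by simp
  then show False using assms by (auto simp: proper_cone_def)
qed

text \<open>Here \<open>z\<close> may be a boundary point: properness supplies
  \<open>- z \<notin> closure C\<close>, which is what the gauge lemmas require. Consequently
  \<open>rfunk_horo C b z\<close> is non-expansive for the reverse-Funk metric.\<close>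

lemma rfunk_triangle:
  assumes C: "proper_cone C" and z: "z \<in> closure C" "z \<noteq> 0" and wv: "w \<in> C" "v \<in> C"
  shows "rfunk C w z \<le> rfunk C w v + rfunk C v z"
proof -
  have oc: "open_cone C" using C by (simp add: proper_cone_def)
  note C0 = proper_cone_zero_notin[OF C]
  note nz = proper_cone_uminus_notin[OF C z]
  have cl: "w \<in> closure C" "v \<in> closure C" using wv closure_subset by auto
  obtain l m where lm: "l *\<^sub>R v - z \<in> closure C" "m *\<^sub>R w - z \<in> closure C"
    using open_cone_dominates[OF oc] wv by meson
  have "Mcone C z w \<le> Mcone C z v * Mcone C v w"
    using Mcone_triangle[OF oc cl nz _ lm(1)] open_cone_uminus_notin_closure[OF oc C0 wv(2)]
      open_cone_dominates[OF oc wv(1)] by blast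
  moreover have "0 < Mcone C z w" "0 < Mcone C z v" "0 < Mcone C v w"
    using Mcone_pos[OF oc cl(1) nz lm(2)] Mcone_pos[OF oc cl(2) nz lm(1)]
      Mcone_pos_open[OF oc C0 wv] by auto
  ultimately show ?thesis
    unfolding rfunk_def by (simp add: mult.commute flip: ln_mult_pos)
qed

text \<open>The triangle inequality in \<open>T\<close>, followed by monotonicity of the gauge in
  the cone. Measuring the first leg in \<open>C\<close> makes \<open>funk_horo T b p\<close>
  non-expansive for the Funk metric of \<open>C\<close>.\<close>

lemma funk_triangle:
  assumes C: "open_cone C" "0 \<notin> C" and T: "open_cone T" "0 \<notin> T" "C \<subseteq> T"
    and "w \<in> C" "v \<in> C" "p \<in> T"
  shows "funk T w p \<le> funk C w v + funk T v p"
proof -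
  have wv: "w \<in> T" "v \<in> T" using assms by auto
  have pos: "0 < Mcone T w p" "0 < Mcone T v p" "0 < Mcone C w v"
    using Mcone_pos_open assms wv by blast+
  have "Mcone T w p \<le> Mcone T w v * Mcone T v p"
    using Mcone_triangle_open[OF T(1,2)] wv assms by blast
  also have "\<dots> \<le> Mcone C w v * Mcone T v p"
    using Mcone_antimono[OF C T] pos assms by (intro mult_right_mono) auto
  finally show ?thesis
    using pos unfolding funk_def by (simp flip: ln_mult_pos)
qed

lemma hilbert_self:
  assumes "open_cone C" "0 \<notin> C" "w \<in> C" shows "hilbert C w w = 0"
  using Mcone_refl[OF assms] by (simp add: hilbert_def funk_def rfunk_def)

section \<open>Tangent cones\<close>

text \<open>The tangent cone consists of the translates of \<open>T\<close> by negative multiples of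
  \<open>z\<close>. Its closure contains \<open>z\<close> and \<open>- z\<close>, so
  \<open>z\<close> spans a direction of translation invariance.\<close>

lemma
  assumes T: "open_cone T" "0 \<notin> T" and z: "z \<in> frontier T"
  shows open_cone_tangent_cone: "open_cone (tangent_cone T z)"
    and zero_notin_tangent_cone: "0 \<notin> tangent_cone T z"
    and subset_tangent_cone: "T \<subseteq> tangent_cone T z"
    and uminus_in_closure_tangent_cone: "- z \<in> closure (tangent_cone T z)"
    and tangent_cone_shift: "v \<in> tangent_cone T z \<Longrightarrow> \<exists>s>0. v + s *\<^sub>R z \<in> T"
proof -
  have K: "open T" "convex T" "\<And>l x. l > 0 \<Longrightarrow> x \<in> T \<Longrightarrow> l *\<^sub>R x \<in> T" "T \<noteq> {}"
    using T by (auto simp: open_cone_def)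
  have zT: "z \<notin> T" "z \<in> closure T"
    using z K(1) by (auto simp: frontier_def interior_open)
  \<comment> \<open>In this form openness is immediate, and membership of \<open>v\<close> becomes
    \<open>v + s *\<^sub>R z \<in> T\<close> for some positive \<open>s\<close>.\<close>
  have eq: "tangent_cone T z = (\<Union>s\<in>{0<..}. (\<lambda>w. - (s *\<^sub>R z) + w) ` T)"
  proof (intro subset_antisym subsetI)
    fix v assume "v \<in> tangent_cone T z"
    then obtain l w where "l > 0" "w \<in> T" "v = l *\<^sub>R (w - z)"
      by (auto simp: tangent_cone_def)
    then show "v \<in> (\<Union>s\<in>{0<..}. (\<lambda>w. - (s *\<^sub>R z) + w) ` T)"
      using K(3) by (auto simp: algebra_simps intro!: bexI[of _ l] image_eqI[of _ _ "l *\<^sub>R w"])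
  next
    fix v assume "v \<in> (\<Union>s\<in>{0<..}. (\<lambda>w. - (s *\<^sub>R z) + w) ` T)"
    then obtain s w where s: "s > 0" "w \<in> T" "v = - (s *\<^sub>R z) + w" by auto
    then have "v = s *\<^sub>R ((1/s) *\<^sub>R w - z)" by (simp add: algebra_simps)
    then show "v \<in> tangent_cone T z"
      using s K(3)[of "1/s" w] by (auto simp: tangent_cone_def)
  qed
  show sh: "\<exists>s>0. v + s *\<^sub>R z \<in> T" if "v \<in> tangent_cone T z" for v
    using that unfolding eq by (auto simp: algebra_simps)
  have mem: "v \<in> tangent_cone T z" if "s > 0" "v + s *\<^sub>R z \<in> T" for v s
    using that unfolding eq by (auto intro!: bexI[of _ s] image_eqI[of _ _ "v + s *\<^sub>R z"])
  show "0 \<notin> tangent_cone T z"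
    using zT(1) by (auto simp: tangent_cone_def)
  show sub: "T \<subseteq> tangent_cone T z"
    using open_cone_add_closure[OF T(1) _ zT(2)] mem[of 1] by auto
  show "open_cone (tangent_cone T z)"
    unfolding open_cone_def
  proof (intro conjI allI impI ballI)
    show "tangent_cone T z \<noteq> {}" using sub K(4) by blast
    show "open (tangent_cone T z)"
      unfolding eq using K(1) by (intro open_UN ballI open_translation)
    show "l *\<^sub>R v \<in> tangent_cone T z" if "l > 0" "v \<in> tangent_cone T z" for l v
    proof -
      obtain s where s: "s > 0" "v + s *\<^sub>R z \<in> T" using sh \<open>v \<in> _\<close> by blast
      then have "l *\<^sub>R v + (l * s) *\<^sub>R z \<in> T"
        using K(3)[OF that(1) s(2)] by (simp add: algebra_simps)
      then show ?thesis using s that by (intro mem[of "l * s"]) auto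
    qed
    show "convex (tangent_cone T z)"
    proof (rule convexI)
      fix v v' and u u' :: real
      assume uu: "v \<in> tangent_cone T z" "v' \<in> tangent_cone T z" "0 \<le> u" "0 \<le> u'" "u + u' = 1"
      obtain s s' where s: "s > 0" "v + s *\<^sub>R z \<in> T" "s' > 0" "v' + s' *\<^sub>R z \<in> T"
        using sh uu by meson
      have "u *\<^sub>R (v + s *\<^sub>R z) + u' *\<^sub>R (v' + s' *\<^sub>R z) \<in> T"
        using K(2) s uu by (intro convexD) auto
      then have "(u *\<^sub>R v + u' *\<^sub>R v') + (u * s + u' * s') *\<^sub>R z \<in> T"
        by (simp add: algebra_simps)
      moreover have "u * s + u' * s' > 0"
        using uu s by (cases "u = 0") (auto intro!: add_pos_nonneg)
      ultimately show "u *\<^sub>R v + u' *\<^sub>R v' \<in> tangent_cone T z"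
        using mem by blast
    qed
  qed
  obtain c where c: "c \<in> T" using K(4) by blast
  have "(\<lambda>n. inverse (real (Suc n)) *\<^sub>R c - z) \<longlonglongrightarrow> 0 *\<^sub>R c - z"
    by (intro tendsto_intros LIMSEQ_inverse_real_of_nat)
  moreover have "inverse (real (Suc n)) *\<^sub>R c - z \<in> tangent_cone T z" for n
    using K(3)[OF _ c] by (intro mem[of 1]) auto
  ultimately show "- z \<in> closure (tangent_cone T z)"
    unfolding closure_sequential
    by (intro exI[of _ "\<lambda>n. inverse (real (Suc n)) *\<^sub>R c - z"]) simp
qed

section \<open>Iterated tangent cones and the propagation of ratio bounds\<close>

lemma Gamma_pow_SucE:
  assumes "S \<in> (Gamma ^^ Suc k) P"
  obtains R z where "S = tangent_cone R z" "R \<in> (Gamma ^^ k) P" "z \<in> frontier R"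
  using assms unfolding funpow.simps comp_apply Gamma_def[of "(Gamma ^^ k) P"] by blast

lemma Gamma_pow_mono: "P \<subseteq> Q \<Longrightarrow> (Gamma ^^ k) P \<subseteq> (Gamma ^^ k) Q"
proof (induction k)
  case (Suc k)
  show ?case
    using Suc.IH[OF Suc.prems] unfolding funpow.simps comp_apply Gamma_def[of "(Gamma ^^ k) _"]
    by blast
qed simp

text \<open>A tangent cone of \<open>C\<close> is one application of \<open>Gamma\<close> to
  \<open>{C}\<close>, so iterating from it is iterating from \<open>C\<close> with one step more.
  Only the existence of a chain starting at \<open>C\<close> matters afterwards.\<close>

lemma cone_tangents_tangent_cone:
  assumes "S \<in> cone_tangents (tangent_cone C x)" "x \<in> frontier C"
  obtains k where "S \<in> (Gamma ^^ k) {C}"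
proof -
  obtain k where k: "S \<in> (Gamma ^^ k) {tangent_cone C x}"
    using assms(1) by (auto simp: cone_tangents_def)
  have "{tangent_cone C x} \<subseteq> Gamma {C}"
    using assms(2) by (auto simp: Gamma_def)
  then have "S \<in> (Gamma ^^ Suc k) {C}"
    using Gamma_pow_mono k unfolding funpow_Suc_right comp_apply by blast
  then show ?thesis by (rule that)
qed

lemma Gamma_pow_open_cone:
  assumes "open_cone A" "0 \<notin> A" "S \<in> (Gamma ^^ k) {A}"
  shows "open_cone S \<and> 0 \<notin> S \<and> A \<subseteq> S"
  using assms(3)
proof (induction k arbitrary: S)
  case (Suc k)
  then obtain S' z where S: "S = tangent_cone S' z" "S' \<in> (Gamma ^^ k) {A}" "z \<in> frontier S'"
    by (elim Gamma_pow_SucE)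
  with Suc.IH[OF S(2)] show ?case
    using open_cone_tangent_cone zero_notin_tangent_cone subset_tangent_cone by blast
qed (use assms in auto)

text \<open>An upper bound for M(w/q;T) / M(w/p;S) on A propagates along a chain of iterated tangent
  cones: letting w run off in the direction of a tangency point z shows that T is invariant under
  translation by z, and so are S and hence the quotient.\<close>

lemma Gamma_pow_ratio_bound:
  assumes A: "open_cone A" "0 \<notin> A" and T: "open_cone T" "0 \<notin> T" "A \<subseteq> T" "q \<in> T"
    and S: "open_cone S" "0 \<notin> S" "p \<in> S"
    and bound: "\<And>w. w \<in> A \<Longrightarrow> Mcone T w q \<le> K * Mcone S w p"
    and S': "S' \<in> (Gamma ^^ k) {A}" "S' \<subseteq> S"
  shows "S' \<subseteq> T \<and> (\<forall>w\<in>S'. Mcone T w q \<le> K * Mcone S w p)"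
  using S'
proof (induction k arbitrary: S')
  case 0
  then show ?case using T bound by auto
next
  case (Suc k)
  then obtain R z where R: "S' = tangent_cone R z" "R \<in> (Gamma ^^ k) {A}" "z \<in> frontier R"
    by (elim Gamma_pow_SucE)
  have Ro: "open_cone R" "0 \<notin> R"
    using Gamma_pow_open_cone[OF A R(2)] by auto
  have RS: "R \<subseteq> S"
    using subset_tangent_cone[OF Ro R(3)] R(1) Suc.prems by auto
  from Suc.IH[OF R(2) RS] have RT: "R \<subseteq> T"
    and bR: "\<And>w. w \<in> R \<Longrightarrow> Mcone T w q \<le> K * Mcone S w p" by auto
  have zR: "z \<in> closure R" using R(3) by (auto simp: frontier_def)
  have zS: "z \<in> closure S" using zR RS closure_mono by blast
  have mzS: "- z \<in> closure S"
    using uminus_in_closure_tangent_cone[OF Ro R(3)] R(1) Suc.prems closure_mono by blast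
  have zT: "z \<in> closure T" using zR RT closure_mono by blast
  obtain w where w: "w \<in> R" using Ro by (auto simp: open_cone_def)
  \<comment> \<open>The sign of \<open>K\<close> is not known at this point, hence the absolute
    value.\<close>
  define L where "L = \<bar>K\<bar> * Mcone S w p"
  \<comment> \<open>Moving \<open>w\<close> by multiples of \<open>z\<close> stays in
    \<open>R\<close> and does not increase the gauge of \<open>S\<close>, because \<open>- z\<close>
    lies in \<open>closure S\<close>. So \<open>L\<close> bounds the gauge of \<open>T\<close>
    uniformly along the ray, and dividing by the length of the shift leaves \<open>- z\<close> in
    the limit.\<close>
  have "inverse (real (Suc n)) *\<^sub>R (L *\<^sub>R q - w) - z \<in> closure T" for n
  proof -
    let ?N = "real (Suc n)"
    have wn: "w + ?N *\<^sub>R z \<in> R"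
      using zR w by (intro open_cone_add_closure closure_open_cone_scaleR Ro) auto
    have "(Mcone S w p *\<^sub>R p - w) + ?N *\<^sub>R (- z) \<in> closure S"
      using Mcone_le_iff_open[OF S, of w "Mcone S w p"] w RS mzS
      by (intro closure_open_cone_add closure_open_cone_scaleR S) auto
    then have "Mcone S w p *\<^sub>R p - (w + ?N *\<^sub>R z) \<in> closure S"
      by (simp add: algebra_simps)
    then have le: "Mcone S (w + ?N *\<^sub>R z) p \<le> Mcone S w p"
      using Mcone_le_iff_open[OF S, of "w + ?N *\<^sub>R z"] wn RS by blast
    have "Mcone T (w + ?N *\<^sub>R z) q \<le> K * Mcone S (w + ?N *\<^sub>R z) p"
      using bR wn by blast
    also have "\<dots> \<le> \<bar>K\<bar> * Mcone S (w + ?N *\<^sub>R z) p"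
      using Mcone_pos_open[OF S, of "w + ?N *\<^sub>R z"] wn RS
      by (intro mult_right_mono) auto
    also have "\<dots> \<le> L"
      unfolding L_def by (intro mult_left_mono le) auto
    finally have "L *\<^sub>R q - (w + ?N *\<^sub>R z) \<in> closure T"
      using Mcone_le_iff_open[OF T(1,2,4)] wn RT by blast
    then have "inverse ?N *\<^sub>R (L *\<^sub>R q - (w + ?N *\<^sub>R z)) \<in> closure T"
      by (intro closure_open_cone_scaleR T) auto
    moreover have "inverse ?N *\<^sub>R (L *\<^sub>R q - (w + ?N *\<^sub>R z)) = inverse ?N *\<^sub>R (L *\<^sub>R q - w) - z"
      by (simp add: scaleR_diff_right scaleR_add_right del: of_nat_Suc)
    ultimately show ?thesis by metis
  qed
  moreover have "(\<lambda>n. inverse (real (Suc n)) *\<^sub>R (L *\<^sub>R q - w) - z) \<longlonglongrightarrow> 0 *\<^sub>R (L *\<^sub>R q - w) - z"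
    by (intro tendsto_intros LIMSEQ_inverse_real_of_nat)
  ultimately have mzT: "- z \<in> closure T"
    using closed_sequentially[OF closed_closure] by fastforce
  have "v \<in> T \<and> Mcone T v q \<le> K * Mcone S v p" if v: "v \<in> S'" for v
  proof -
    \<comment> \<open>The bound is known at the shifted point in \<open>R\<close>. Shifting back
      does not increase the gauge of \<open>T\<close>, since \<open>z \<in> closure T\<close>;
      shifting forward does not increase that of \<open>S\<close>, since
      \<open>- z \<in> closure S\<close>.\<close>
    obtain s where s: "s > 0" "v + s *\<^sub>R z \<in> R"
      using tangent_cone_shift[OF Ro R(3)] v R(1) by blast
    let ?w = "v + s *\<^sub>R z"
    have wTS: "?w \<in> T" "?w \<in> S" using s RT RS by auto
    have "?w + s *\<^sub>R (- z) \<in> T"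
      by (rule open_cone_add_closure[OF T(1) wTS(1) closure_open_cone_scaleR[OF T(1) mzT]])
        (use s in simp)
    then have vT: "v \<in> T" by simp
    have vS: "v \<in> S" using v Suc.prems by auto
    have "(Mcone T ?w q *\<^sub>R q - ?w) + s *\<^sub>R z \<in> closure T"
      using Mcone_le_iff_open[OF T(1,2,4) wTS(1), of "Mcone T ?w q"] s zT
      by (intro closure_open_cone_add closure_open_cone_scaleR T) auto
    then have "Mcone T ?w q *\<^sub>R q - v \<in> closure T" by (simp add: algebra_simps)
    then have 1: "Mcone T v q \<le> Mcone T ?w q"
      using Mcone_le_iff_open[OF T(1,2,4) vT] by blast
    have "(Mcone S v p *\<^sub>R p - v) + s *\<^sub>R (- z) \<in> closure S"
      using Mcone_le_iff_open[OF S vS, of "Mcone S v p"] s mzS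
      by (intro closure_open_cone_add closure_open_cone_scaleR S) auto
    then have "Mcone S v p *\<^sub>R p - ?w \<in> closure S" by (simp add: algebra_simps)
    then have 2: "Mcone S ?w p \<le> Mcone S v p"
      using Mcone_le_iff_open[OF S wTS(2)] by blast
    have 3: "Mcone T ?w q \<le> K * Mcone S ?w p" using bR s by blast
    \<comment> \<open>Positivity of the gauges forces the sign of \<open>K\<close>, which allows the
      last comparison to be multiplied by it.\<close>
    have "0 < K * Mcone S ?w p"
      using 3 Mcone_pos_open[OF T(1,2,4) wTS(1)] by linarith
    then have "K \<ge> 0"
      using Mcone_pos_open[OF S wTS(2)] by (simp add: zero_less_mult_iff)
    then have "K * Mcone S ?w p \<le> K * Mcone S v p"
      using 2 by (rule mult_left_mono[rotated])
    with 1 3 vT show ?thesis by linarith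
  qed
  then show ?case by auto
qed

section \<open>Faces of the closed cone\<close>

text \<open>The face is the order ideal generated by \<open>x\<close> in the order defined by the
  closed cone. A segment around \<open>x\<close> pointing towards \<open>y\<close> can be extended
  beyond \<open>x\<close> precisely when some multiple of \<open>x\<close> dominates
  \<open>y\<close>.\<close>

lemma cone_face_eq:
  assumes C: "open_cone C" and x: "x \<in> closure C" "x \<noteq> 0"
  shows "cone_face C x = {y \<in> closure C. \<exists>l. l *\<^sub>R x - y \<in> closure C}"
proof (intro subset_antisym subsetI)
  fix y assume "y \<in> cone_face C x"
  then obtain a c where y: "y \<in> closure C" and ac: "a \<noteq> c" "open_segment a c \<subseteq> closure C"
    "x \<in> open_segment a c" "collinear {x, y, a, c}"
    by (auto simp: cone_face_def)
  have "closed_segment a c \<subseteq> closure C"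
    using closure_mono[OF ac(2)] ac(1) by simp
  then have acC: "a \<in> closure C" "c \<in> closure C" by auto
  obtain t where t: "0 < t" "t < 1" "x = (1 - t) *\<^sub>R a + t *\<^sub>R c"
    using ac(3) by (auto simp: in_segment)
  obtain u where u: "\<forall>v\<in>{x,y,a,c}. \<forall>w\<in>{x,y,a,c}. \<exists>k. v - w = k *\<^sub>R u"
    using ac(4) unfolding collinear_def by blast
  obtain k where k: "c - a = k *\<^sub>R u" using u by blast
  obtain j where j: "y - x = j *\<^sub>R u" using u by blast
  have "k \<noteq> 0" using k ac(1) by auto
  define s where "s = j / k"
  have s: "y = x + s *\<^sub>R (c - a)"
    using j k \<open>k \<noteq> 0\<close> by (simp add: s_def algebra_simps)
  \<comment> \<open>Expanding \<open>(l + 1) *\<^sub>R x - y\<close> in \<open>a\<close> and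
    \<open>c\<close> gives coefficients \<open>l * (1 - t) + s\<close> and \<open>l * t - s\<close>;
    this \<open>l\<close> makes both nonnegative whatever the sign of \<open>s\<close>.\<close>
  define l where "l = \<bar>s\<bar> / t + \<bar>s\<bar> / (1 - t)"
  have l: "l * t \<ge> s" "l * (1 - t) \<ge> - s"
  proof -
    have "l * t = \<bar>s\<bar> + \<bar>s\<bar> / (1 - t) * t" "l * (1 - t) = \<bar>s\<bar> + \<bar>s\<bar> / t * (1 - t)"
      using t unfolding l_def by (auto simp: field_simps)
    moreover have "\<bar>s\<bar> / (1 - t) * t \<ge> 0" "\<bar>s\<bar> / t * (1 - t) \<ge> 0"
      using t by auto
    ultimately show "l * t \<ge> s" "l * (1 - t) \<ge> - s" by linarith+
  qed
  have "(l * (1 - t) + s) *\<^sub>R a + (l * t - s) *\<^sub>R c \<in> closure C"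
    using l acC by (intro closure_open_cone_add closure_open_cone_scaleR C) auto
  also have "(l * (1 - t) + s) *\<^sub>R a + (l * t - s) *\<^sub>R c = (l + 1) *\<^sub>R x - y"
    unfolding s t(3) by (simp add: algebra_simps)
  finally show "y \<in> {y \<in> closure C. \<exists>l. l *\<^sub>R x - y \<in> closure C}"
    using y by auto
next
  fix y assume "y \<in> {y \<in> closure C. \<exists>l. l *\<^sub>R x - y \<in> closure C}"
  then obtain l where y: "y \<in> closure C" and l: "l *\<^sub>R x - y \<in> closure C" by auto
  have conv: "convex (closure C)"
    using C by (auto simp: open_cone_def convex_closure)
  show "y \<in> cone_face C x"
  proof (cases "y = x")
    case True
    \<comment> \<open>With \<open>y = x\<close> there is no line through two points to follow; the
      ray through \<open>x\<close>, nondegenerate as \<open>x \<noteq> 0\<close>, provides the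
      segment.\<close>
    let ?a = "(1/2) *\<^sub>R x" and ?c = "(3/2) *\<^sub>R x"
    have seg: "?a \<in> closure C" "?c \<in> closure C"
      using closure_open_cone_scaleR[OF C x(1)] by auto
    have "midpoint ?a ?c = x" by (simp add: midpoint_def flip: scaleR_left.add)
    moreover have "?a \<noteq> ?c" using x by simp
    ultimately have xs: "x \<in> open_segment ?a ?c"
      using midpoint_in_open_segment[of ?a ?c] by simp
    have "collinear {x, y, ?a, ?c}"
      using xs by (intro collinear_subset[OF collinear_closed_segment[of ?a ?c]])
        (auto simp: True open_segment_def)
    moreover have "open_segment ?a ?c \<subseteq> closure C"
      using closed_segment_subset[OF seg conv] by (auto simp: open_segment_def)
    ultimately show ?thesis
      using xs \<open>?a \<noteq> ?c\<close> y unfolding cone_face_def by blast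
  next
    case False
    \<comment> \<open>The segment is prolonged past \<open>x\<close> by \<open>d\<close> times
      \<open>x - y\<close>. The new endpoint is \<open>(1 + d - d * l) *\<^sub>R x + d *\<^sub>R (l
      *\<^sub>R x - y)\<close>, and \<open>d * l \<le> 1\<close> keeps the first coefficient
      nonnegative.\<close>
    define d where "d = 1 / (1 + \<bar>l\<bar>)"
    define c where "c = x + d *\<^sub>R (x - y)"
    have d: "d > 0" "1 + d - d * l \<ge> 0"
    proof -
      show "d > 0" by (simp add: d_def)
      have "d * l \<le> 1" unfolding d_def by (auto simp: divide_simps)
      with \<open>d > 0\<close> show "1 + d - d * l \<ge> 0" by linarith
    qed
    have "(1 + d - d * l) *\<^sub>R x + d *\<^sub>R (l *\<^sub>R x - y) \<in> closure C"
      using d x l by (intro closure_open_cone_add closure_open_cone_scaleR C) auto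
    then have c: "c \<in> closure C" by (simp add: c_def algebra_simps)
    have yc: "c - y = (1 + d) *\<^sub>R (x - y)" by (simp add: c_def algebra_simps)
    then have ne: "y \<noteq> c" using False d by auto
    have "x - y = (1 / (1 + d)) *\<^sub>R (c - y)" using d yc by simp
    then have "x = (1 - 1 / (1 + d)) *\<^sub>R y + (1 / (1 + d)) *\<^sub>R c"
      by (simp add: algebra_simps)
    then have xs: "x \<in> open_segment y c"
      using d ne unfolding in_segment by (intro conjI exI[of _ "1 / (1 + d)"]) auto
    have "collinear {x, y, y, c}"
      using xs by (intro collinear_subset[OF collinear_closed_segment[of y c]])
        (auto simp: open_segment_def)
    moreover have "open_segment y c \<subseteq> closure C"
      using closed_segment_subset[OF y c conv] by (auto simp: open_segment_def)
    ultimately show ?thesis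
      using xs ne y unfolding cone_face_def by blast
  qed
qed

lemma self_in_cone_face:
  assumes "open_cone C" "x \<in> closure C" "x \<noteq> 0"
  shows "x \<in> cone_face C x"
proof -
  have "1 *\<^sub>R x - x \<in> closure C"
    using closure_open_cone_scaleR[OF assms(1,2), of 0] by simp
  then show ?thesis unfolding cone_face_eq[OF assms] using assms(2) by blast
qed

text \<open>Generating the same order ideal amounts to mutual domination, by transitivity of
  domination.\<close>

lemma cone_face_eq_iff:
  assumes C: "open_cone C" and x: "x \<in> closure C" "x \<noteq> 0" and y: "y \<in> closure C" "y \<noteq> 0"
  shows "cone_face C x = cone_face C y \<longleftrightarrow>
    (\<exists>l. l *\<^sub>R x - y \<in> closure C) \<and> (\<exists>l. l *\<^sub>R y - x \<in> closure C)"
proof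
  assume "cone_face C x = cone_face C y"
  moreover have "x \<in> cone_face C x" "y \<in> cone_face C y"
    using self_in_cone_face C x y by auto
  ultimately show "(\<exists>l. l *\<^sub>R x - y \<in> closure C) \<and> (\<exists>l. l *\<^sub>R y - x \<in> closure C)"
    unfolding cone_face_eq[OF C x] cone_face_eq[OF C y] by blast
next
  have trans: "\<exists>l. l *\<^sub>R u - w \<in> closure C"
    if "l *\<^sub>R u - v \<in> closure C" "m *\<^sub>R v - w \<in> closure C" "v \<in> closure C" for l m u v w
  proof -
    \<comment> \<open>The multiplier \<open>m\<close> may be negative, so
      \<open>\<bar>m\<bar>\<close> is used and the excess in \<open>v\<close> is added back.\<close>
    have "(\<bar>m\<bar> *\<^sub>R (l *\<^sub>R u - v) + (\<bar>m\<bar> - m) *\<^sub>R v) + (m *\<^sub>R v - w) \<in> closure C"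
      using that by (intro closure_open_cone_add closure_open_cone_scaleR C) auto
    then have "(\<bar>m\<bar> * l) *\<^sub>R u - w \<in> closure C" by (simp add: algebra_simps)
    then show ?thesis ..
  qed
  assume "(\<exists>l. l *\<^sub>R x - y \<in> closure C) \<and> (\<exists>l. l *\<^sub>R y - x \<in> closure C)"
  then obtain l m where "l *\<^sub>R x - y \<in> closure C" "m *\<^sub>R y - x \<in> closure C" by blast
  note lm = trans[OF this(1) _ y(1)] trans[OF this(2) _ x(1)]
  show "cone_face C x = cone_face C y"
    unfolding cone_face_eq[OF C x] cone_face_eq[OF C y] by (intro Collect_cong) (metis lm)
qed

text \<open>If \<open>l *\<^sub>R x - y\<close> is in the closed cone, it is dominated by
  \<open>(l * m) *\<^sub>R z\<close> and so already belongs to the face. Hence the metric of the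
  face can be computed with the gauge of \<open>C\<close>.\<close>

lemma Mcone_cone_face:
  assumes C: "open_cone C" and z: "z \<in> closure C" "z \<noteq> 0"
    and x: "x \<in> cone_face C z" "y \<in> cone_face C z"
  shows "Mcone (cone_face C z) y x = Mcone C y x"
proof -
  obtain m where m: "m *\<^sub>R z - x \<in> closure C" and xy: "x \<in> closure C" "y \<in> closure C"
    using x unfolding cone_face_eq[OF C z] by auto
  have "l *\<^sub>R x - y \<in> closure (cone_face C z) \<longleftrightarrow> l *\<^sub>R x - y \<in> closure C" if "l > 0" for l
  proof
    assume "l *\<^sub>R x - y \<in> closure C"
    moreover have "l *\<^sub>R (m *\<^sub>R z - x) + y \<in> closure C"
      using that m xy by (intro closure_open_cone_add closure_open_cone_scaleR C) auto
    then have "(l * m) *\<^sub>R z - (l *\<^sub>R x - y) \<in> closure C" by (simp add: algebra_simps)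
    ultimately have "l *\<^sub>R x - y \<in> cone_face C z"
      unfolding cone_face_eq[OF C z] by blast
    then show "l *\<^sub>R x - y \<in> closure (cone_face C z)" using closure_subset by blast
  next
    have "cone_face C z \<subseteq> closure C" by (auto simp: cone_face_def)
    then have "closure (cone_face C z) \<subseteq> closure C" by (rule closure_minimal) simp
    then show "l *\<^sub>R x - y \<in> closure (cone_face C z) \<Longrightarrow> l *\<^sub>R x - y \<in> closure C" by blast
  qed
  then show ?thesis unfolding Mcone_def by (intro arg_cong[where f = Inf]) auto
qed

section \<open>Almost-geodesics and two-sided estimates of the detour cost\<close>

lemma eventually_path_filter:
  "eventually P (path_filter T0) \<longleftrightarrow> (\<exists>M. \<forall>t\<in>T0. M \<le> t \<longrightarrow> P t)"
  unfolding path_filter_def eventually_inf_principal eventually_at_top_linorder by blast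

lemma path_filter_neq_bot:
  assumes "is_path C T0 \<gamma>" shows "path_filter T0 \<noteq> bot"
  using assms unfolding trivial_limit_def eventually_path_filter is_path_def by blast

lemma eventually_path_filter_in:
  assumes "is_path C T0 \<gamma>" shows "eventually (\<lambda>t. \<gamma> t \<in> C) (path_filter T0)"
  using assms unfolding eventually_path_filter is_path_def by blast

lemma ucc_tendsto_pointwise:
  assumes "ucc_tendsto C \<Phi> \<xi> F" "w \<in> C"
  shows "((\<lambda>t. \<Phi> t w) \<longlongrightarrow> \<xi> w) F"
  unfolding tendsto_iff dist_real_def
  using assms unfolding ucc_tendsto_def
  by (auto dest!: spec[of _ "{w}"])

text \<open>For \<open>u = \<gamma> 0\<close> this is the almost-geodesic condition after letting
  its later time tend to infinity. Other \<open>u\<close> follow because \<open>hilbert C u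
  (\<gamma> s) - hilbert C (\<gamma> 0) (\<gamma> s)\<close> is a difference of two values of
  \<open>horo\<close>, whose limits are known.\<close>

lemma almost_geodesic_tendsto:
  assumes ag: "almost_geodesic C T0 \<gamma>"
    and lim: "\<And>w. w \<in> C \<Longrightarrow> ((\<lambda>t. horo C b (\<gamma> t) w) \<longlongrightarrow> \<xi> w) (path_filter T0)"
    and self: "\<And>w. w \<in> C \<Longrightarrow> hilbert C w w = 0" and u: "u \<in> C"
  shows "((\<lambda>t. hilbert C u (\<gamma> t) + \<xi> (\<gamma> t)) \<longlongrightarrow> \<xi> u) (path_filter T0)"
proof -
  let ?d = "hilbert C"
  have path: "is_path C T0 \<gamma>" using ag by (simp add: almost_geodesic_def)
  then have \<gamma>: "\<gamma> t \<in> C" if "t \<in> T0" for t using that by (auto simp: is_path_def)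
  have 0: "\<gamma> 0 \<in> C" using path by (auto simp: is_path_def)
  note nb = path_filter_neq_bot[OF path]
  have "((\<lambda>s. ?d (\<gamma> 0) (\<gamma> s) + \<xi> (\<gamma> s)) \<longlongrightarrow> \<xi> (\<gamma> 0)) (path_filter T0)"
    unfolding tendsto_iff dist_real_def
  proof (intro allI impI)
    fix e :: real assume "e > 0"
    then obtain M where M: "\<And>s t. s \<in> T0 \<Longrightarrow> t \<in> T0 \<Longrightarrow> M \<le> s \<Longrightarrow> s \<le> t \<Longrightarrow>
        \<bar>?d (\<gamma> 0) (\<gamma> s) + ?d (\<gamma> s) (\<gamma> t) - t\<bar> < e / 3"
      using ag unfolding almost_geodesic_def by (metis zero_less_divide_iff zero_less_numeral)
    have "\<bar>?d (\<gamma> 0) (\<gamma> s) + \<xi> (\<gamma> s) - \<xi> (\<gamma> 0)\<bar> < e" if s: "s \<in> T0" "M \<le> s" for s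
    proof -
      have "((\<lambda>t. \<bar>?d (\<gamma> 0) (\<gamma> s) + horo C b (\<gamma> t) (\<gamma> s) - horo C b (\<gamma> t) (\<gamma> 0)\<bar>)
          \<longlongrightarrow> \<bar>?d (\<gamma> 0) (\<gamma> s) + \<xi> (\<gamma> s) - \<xi> (\<gamma> 0)\<bar>) (path_filter T0)"
        using \<gamma> s 0 by (intro tendsto_intros lim) auto
      moreover have "eventually (\<lambda>t.
          \<bar>?d (\<gamma> 0) (\<gamma> s) + horo C b (\<gamma> t) (\<gamma> s) - horo C b (\<gamma> t) (\<gamma> 0)\<bar> \<le> 2 * (e / 3))
          (path_filter T0)"
        unfolding eventually_path_filter
      proof (intro exI[of _ s] ballI impI)
        fix t assume t: "t \<in> T0" "s \<le> t"
        \<comment> \<open>The almost-geodesic condition with both times equal to \<open>t\<close>;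
          the second distance vanishes.\<close>
        have "\<bar>?d (\<gamma> 0) (\<gamma> t) - t\<bar> < e / 3"
          using M[OF t(1) t(1)] t s self[OF \<gamma>[OF t(1)]] by simp
        with M[OF s(1) t(1) s(2) t(2)]
        show "\<bar>?d (\<gamma> 0) (\<gamma> s) + horo C b (\<gamma> t) (\<gamma> s) - horo C b (\<gamma> t) (\<gamma> 0)\<bar> \<le> 2 * (e / 3)"
          unfolding horo_def by linarith
      qed
      ultimately have "\<bar>?d (\<gamma> 0) (\<gamma> s) + \<xi> (\<gamma> s) - \<xi> (\<gamma> 0)\<bar> \<le> 2 * (e / 3)"
        using nb tendsto_upperbound by blast
      then show ?thesis using \<open>e > 0\<close> by linarith
    qed
    then show "eventually (\<lambda>s. \<bar>?d (\<gamma> 0) (\<gamma> s) + \<xi> (\<gamma> s) - \<xi> (\<gamma> 0)\<bar> < e) (path_filter T0)"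
      unfolding eventually_path_filter by blast
  qed
  then have "((\<lambda>s. (?d (\<gamma> 0) (\<gamma> s) + \<xi> (\<gamma> s)) + horo C b (\<gamma> s) u - horo C b (\<gamma> s) (\<gamma> 0))
      \<longlongrightarrow> \<xi> (\<gamma> 0) + \<xi> u - \<xi> (\<gamma> 0)) (path_filter T0)"
    by (intro tendsto_intros lim u 0)
  then show ?thesis by (simp add: horo_def add.commute)
qed

text \<open>Along any competing path, the Lipschitz bound at \<open>w\<close> gives \<open>hilbert C
  b (\<gamma> t) + \<eta> (\<gamma> t) \<ge> \<eta> w - horo C b (\<gamma> t) w\<close>, whose right
  side tends to \<open>\<eta> w - \<xi> w\<close>.\<close>

lemma detour_cost_lower:
  assumes w: "w \<in> C" and lip: "\<And>v. v \<in> C \<Longrightarrow> \<eta> w \<le> hilbert C w v + \<eta> v"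
  shows "ereal (\<eta> w - \<xi> w) \<le> detour_cost C b \<xi> \<eta>"
  unfolding detour_cost_def
proof (rule Inf_greatest, clarify)
  fix T0 \<gamma> assume path: "is_path C T0 \<gamma>"
    and ucc: "ucc_tendsto C (\<lambda>t. horo C b (\<gamma> t)) \<xi> (path_filter T0)"
  have "((\<lambda>t. ereal (\<eta> w - horo C b (\<gamma> t) w)) \<longlongrightarrow> ereal (\<eta> w - \<xi> w)) (path_filter T0)"
    by (intro tendsto_intros ucc_tendsto_pointwise[OF ucc w])
  then have "ereal (\<eta> w - \<xi> w) = Liminf (path_filter T0) (\<lambda>t. ereal (\<eta> w - horo C b (\<gamma> t) w))"
    using lim_imp_Liminf[OF path_filter_neq_bot[OF path]] by metis
  also have "\<dots> \<le> Liminf (path_filter T0) (\<lambda>t. ereal (hilbert C b (\<gamma> t) + \<eta> (\<gamma> t)))"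
    by (intro Liminf_mono eventually_mono[OF eventually_path_filter_in[OF path]])
       (use lip in \<open>force simp: horo_def\<close>)
  finally show "ereal (\<eta> w - \<xi> w) \<le> Liminf (path_filter T0) (\<lambda>t. ereal (hilbert C b (\<gamma> t) + \<eta> (\<gamma> t)))" .
qed

text \<open>The given path is itself a competitor, and along it replacing \<open>\<eta>\<close> by
  \<open>\<xi>\<close> costs at most \<open>c\<close>.\<close>

lemma detour_cost_upper:
  assumes path: "is_path C T0 \<gamma>"
    and ucc: "ucc_tendsto C (\<lambda>t. horo C b (\<gamma> t)) \<xi> (path_filter T0)"
    and lim: "((\<lambda>t. hilbert C b (\<gamma> t) + \<xi> (\<gamma> t)) \<longlongrightarrow> 0) (path_filter T0)"
    and le: "\<And>w. w \<in> C \<Longrightarrow> \<eta> w - \<xi> w \<le> c"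
  shows "detour_cost C b \<xi> \<eta> \<le> ereal c"
proof -
  have "detour_cost C b \<xi> \<eta> \<le> Liminf (path_filter T0) (\<lambda>t. ereal (hilbert C b (\<gamma> t) + \<eta> (\<gamma> t)))"
    unfolding detour_cost_def using path ucc by (intro Inf_lower) blast
  also have "\<dots> \<le> Liminf (path_filter T0) (\<lambda>t. ereal (hilbert C b (\<gamma> t) + \<xi> (\<gamma> t) + c))"
    by (intro Liminf_mono eventually_mono[OF eventually_path_filter_in[OF path]])
       (use le in \<open>force simp: algebra_simps\<close>)
  also have "\<dots> = ereal (0 + c)"
    by (intro lim_imp_Liminf path_filter_neq_bot[OF path] tendsto_intros lim)
  finally show ?thesis by simp
qed

section \<open>What uniform bounds on differences of horofunctions say about the cones and boundary
  points\<close>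

text \<open>The bound is tested at \<open>x + b / (n + 1)\<close>, which dominates \<open>x\<close>
  with constant 1. Thus \<open>exp k\<close> times this point dominates \<open>y\<close>, and
  closedness passes to the limit.\<close>

lemma rfunk_difference_bound:
  assumes C: "proper_cone C" and b: "b \<in> C"
    and x: "x \<in> closure C" "x \<noteq> 0" and y: "y \<in> closure C" "y \<noteq> 0"
    and le: "\<And>w. w \<in> C \<Longrightarrow> rfunk C w y - rfunk C w x \<le> k"
  shows "exp k *\<^sub>R x - y \<in> closure C"
proof -
  have oc: "open_cone C" using C by (simp add: proper_cone_def)
  have cl: "w \<in> closure C" if "w \<in> C" for w using that closure_subset by auto
  have "exp k *\<^sub>R (x + inverse (real (Suc n)) *\<^sub>R b) - y \<in> closure C" for n
  proof -
    let ?e = "inverse (real (Suc n))"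
    let ?w = "x + ?e *\<^sub>R b"
    have eb: "?e *\<^sub>R b \<in> C" using oc b by (auto simp: open_cone_def)
    then have w: "?w \<in> C"
      using open_cone_add_closure[OF oc _ x(1)] by (metis add.commute)
    have one: "1 *\<^sub>R ?w - x \<in> closure C" using eb cl by simp
    note Mx = Mcone_le_iff[OF oc cl[OF w] proper_cone_uminus_notin[OF C x] one]
      Mcone_pos[OF oc cl[OF w] proper_cone_uminus_notin[OF C x] one]
    obtain m where m: "m *\<^sub>R ?w - y \<in> closure C"
      using open_cone_dominates[OF oc w] by blast
    note My = Mcone_le_iff[OF oc cl[OF w] proper_cone_uminus_notin[OF C y] m]
      Mcone_pos[OF oc cl[OF w] proper_cone_uminus_notin[OF C y] m]
    have "Mcone C x ?w \<le> 1" using Mx(1) one by blast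
    then have "ln (Mcone C x ?w) \<le> 0" using Mx(2) by simp
    with le[OF w] have "ln (Mcone C y ?w) \<le> k" unfolding rfunk_def by linarith
    then have "Mcone C y ?w \<le> exp k"
      using My(2) ln_le_cancel_iff[of "Mcone C y ?w" "exp k"] by simp
    then show ?thesis using My(1) by blast
  qed
  moreover have "(\<lambda>n. exp k *\<^sub>R (x + inverse (real (Suc n)) *\<^sub>R b) - y)
      \<longlonglongrightarrow> exp k *\<^sub>R (x + 0 *\<^sub>R b) - y"
    by (intro tendsto_intros LIMSEQ_inverse_real_of_nat)
  ultimately show ?thesis
    using closed_sequentially[OF closed_closure] by fastforce
qed

text \<open>Exponentiated, the hypothesis is a ratio bound on \<open>C\<close>. Propagated to all of
  \<open>S\<close>, it can be evaluated at \<open>p\<close>, which need not lie in \<open>C\<close>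
  and where the gauge of \<open>S\<close> is 1.\<close>

lemma funk_difference_bound:
  assumes C: "open_cone C" "0 \<notin> C"
    and S: "S \<in> (Gamma ^^ k) {C}" "p \<in> S" and T: "T \<in> (Gamma ^^ m) {C}" "q \<in> T"
    and le: "\<And>w. w \<in> C \<Longrightarrow> funk T w q - funk S w p \<le> c"
  shows "S \<subseteq> T" "funk T p q \<le> c"
proof -
  have oS: "open_cone S" "0 \<notin> S" "C \<subseteq> S" and oT: "open_cone T" "0 \<notin> T" "C \<subseteq> T"
    using Gamma_pow_open_cone[OF C] S T by blast+
  have "Mcone T w q \<le> exp c * Mcone S w p" if "w \<in> C" for w
  proof -
    have pos: "0 < Mcone T w q" "0 < Mcone S w p"
      using Mcone_pos_open oS oT S T that by blast+
    have "Mcone T w q = exp (funk T w q)" "exp c * Mcone S w p = exp (c + funk S w p)"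
      using pos by (auto simp: funk_def exp_add)
    moreover have "funk T w q \<le> c + funk S w p" using le[OF that] by linarith
    ultimately show ?thesis by simp
  qed
  then have "S \<subseteq> T \<and> (\<forall>w\<in>S. Mcone T w q \<le> exp c * Mcone S w p)"
    by (intro Gamma_pow_ratio_bound[OF C oT T(2) oS(1,2) S(2) _ S(1)]) auto
  then have ST: "S \<subseteq> T" and "Mcone T p q \<le> exp c * Mcone S p p" using S by auto
  moreover have "0 < Mcone T p q" using Mcone_pos_open oT T ST S by blast
  ultimately show "S \<subseteq> T" "funk T p q \<le> c"
    using Mcone_refl[OF oS(1,2) S(2)] ln_le_cancel_iff[of "Mcone T p q" "exp c"]
    by (simp_all add: funk_def)
qed

section \<open>The detour cost from one Busemann point to another\<close>

context
  fixes C S T :: "'a::euclidean_space set" and b x y p q :: 'a and k m :: nat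
    and g h :: "'a \<Rightarrow> real"
  assumes C: "proper_cone C" and b: "b \<in> C"
    and x: "x \<in> closure C" "x \<noteq> 0" and y: "y \<in> closure C" "y \<noteq> 0"
    and S: "S \<in> (Gamma ^^ k) {C}" "p \<in> S" and T: "T \<in> (Gamma ^^ m) {C}" "q \<in> T"
    and g_def: "g = (\<lambda>w. rfunk_horo C b x w + funk_horo S b p w)"
    and h_def: "h = (\<lambda>w. rfunk_horo C b y w + funk_horo T b q w)"
    and busemann_g: "busemann C b g"
begin

private lemma oC: "open_cone C" and C0: "0 \<notin> C"
  using C proper_cone_zero_notin by (auto simp: proper_cone_def)

private lemma oS: "open_cone S" "0 \<notin> S" "C \<subseteq> S" and oT: "open_cone T" "0 \<notin> T" "C \<subseteq> T"
  using Gamma_pow_open_cone[OF oC C0] S T by blast+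

private lemma geodesic:
  obtains T0 \<gamma> where "is_path C T0 \<gamma>" "ucc_tendsto C (\<lambda>t. horo C b (\<gamma> t)) g (path_filter T0)"
    "\<And>u. u \<in> C \<Longrightarrow> ((\<lambda>t. hilbert C u (\<gamma> t) + g (\<gamma> t)) \<longlongrightarrow> g u) (path_filter T0)"
proof -
  obtain T0 \<gamma> where *: "almost_geodesic C T0 \<gamma>"
    "ucc_tendsto C (\<lambda>t. horo C b (\<gamma> t)) g (path_filter T0)"
    using busemann_g unfolding busemann_def by blast
  have "is_path C T0 \<gamma>" using *(1) by (simp add: almost_geodesic_def)
  with * show ?thesis
    using almost_geodesic_tendsto[OF *(1) ucc_tendsto_pointwise[OF *(2)] hilbert_self[OF oC C0]] that
    by blast
qed

text \<open>Along an almost-geodesic converging to g the Funk and the reverse-Funk parts of the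
  triangle inequality are both asymptotically sharp, which is why the two base points w and w'
  may be chosen independently.\<close>

lemma detour_cost_split_lower:
  assumes w: "w \<in> C" "w' \<in> C"
  shows "ereal ((rfunk_horo C b y w' - rfunk_horo C b x w') + (funk_horo T b q w - funk_horo S b p w))
    \<le> detour_cost C b g h" (is "ereal ?V \<le> ?D")
proof -
  obtain T0 \<gamma> where path: "is_path C T0 \<gamma>" and
    lim: "\<And>u. u \<in> C \<Longrightarrow> ((\<lambda>t. hilbert C u (\<gamma> t) + g (\<gamma> t)) \<longlongrightarrow> g u) (path_filter T0)"
    using geodesic by blast
  note ev = eventually_path_filter_in[OF path]
  \<comment> \<open>\<open>A\<close> and \<open>B\<close> are the defects in the reverse-Funk and
    Funk triangle inequalities. Both are nonnegative, and each is at most the total defect at its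
    own point \<open>w'\<close> or \<open>w\<close>, which tends to 0.\<close>
  define A where "A t = rfunk C w' (\<gamma> t) + rfunk_horo C b x (\<gamma> t) - rfunk_horo C b x w'" for t
  define B where "B t = funk C w (\<gamma> t) + funk_horo S b p (\<gamma> t) - funk_horo S b p w" for t
  have rx: "rfunk_horo C b z u \<le> rfunk C u v + rfunk_horo C b z v"
    if "z \<in> closure C" "z \<noteq> 0" "u \<in> C" "v \<in> C" for z u v
    using rfunk_triangle[OF C that] by (simp add: rfunk_horo_def)
  have fS: "funk_horo S b p u \<le> funk C u v + funk_horo S b p v" if "u \<in> C" "v \<in> C" for u v
    using funk_triangle[OF oC C0 oS that S(2)] by (simp add: funk_horo_def)
  have fT: "funk_horo T b q u \<le> funk C u v + funk_horo T b q v" if "u \<in> C" "v \<in> C" for u v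
    using funk_triangle[OF oC C0 oT that T(2)] by (simp add: funk_horo_def)
  have lim0: "((\<lambda>t. hilbert C u (\<gamma> t) + g (\<gamma> t) - g u) \<longlongrightarrow> 0) (path_filter T0)" if "u \<in> C" for u
    using tendsto_diff[OF lim[OF that] tendsto_const[of "g u"]] by simp
  have "(A \<longlongrightarrow> 0) (path_filter T0)"
  proof (rule tendsto_sandwich[OF _ _ tendsto_const lim0[OF w(2)]])
    show "\<forall>\<^sub>F t in path_filter T0. 0 \<le> A t"
      using ev by eventually_elim (use rx[OF x w(2)] in \<open>force simp: A_def\<close>)
    show "\<forall>\<^sub>F t in path_filter T0. A t \<le> hilbert C w' (\<gamma> t) + g (\<gamma> t) - g w'"
      using ev by eventually_elim (use fS[OF w(2)] in \<open>force simp: A_def g_def hilbert_def\<close>)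
  qed
  moreover have "(B \<longlongrightarrow> 0) (path_filter T0)"
  proof (rule tendsto_sandwich[OF _ _ tendsto_const lim0[OF w(1)]])
    show "\<forall>\<^sub>F t in path_filter T0. 0 \<le> B t"
      using ev by eventually_elim (use fS[OF w(1)] in \<open>force simp: B_def\<close>)
    show "\<forall>\<^sub>F t in path_filter T0. B t \<le> hilbert C w (\<gamma> t) + g (\<gamma> t) - g w"
      using ev by eventually_elim (use rx[OF x w(1)] in \<open>force simp: B_def g_def hilbert_def\<close>)
  qed
  ultimately have "((\<lambda>t. ereal (?V - A t - B t)) \<longlongrightarrow> ereal (?V - 0 - 0)) (path_filter T0)"
    by (intro tendsto_intros)
  moreover have "\<forall>\<^sub>F t in path_filter T0. ereal (?V - A t - B t) \<le> ?D"
    using ev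
  proof eventually_elim
    case (elim t)
    have "h (\<gamma> t) \<le> hilbert C (\<gamma> t) v + h v" if "v \<in> C" for v
      using rx[OF y elim that] fT[OF elim that] by (simp add: h_def hilbert_def)
    then have "ereal (h (\<gamma> t) - g (\<gamma> t)) \<le> ?D" by (intro detour_cost_lower elim)
    \<comment> \<open>The terms of \<open>g\<close> at \<open>w\<close> and \<open>w'\<close>
      cancel, leaving non-expansiveness of the two parts of \<open>h\<close> at different
      points.\<close>
    moreover have "?V - A t - B t \<le> h (\<gamma> t) - g (\<gamma> t)"
      using rx[OF y w(2) elim] fT[OF w(1) elim] by (simp add: h_def g_def A_def B_def)
    ultimately show ?case by (meson ereal_less_eq(3) order_trans)
  qed
  ultimately show ?thesis
    using tendsto_upperbound[OF _ _ path_filter_neq_bot[OF path]] by fastforce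
qed

text \<open>A finite cost bounds the two differences of horofunctions independently of each other.
  Freezing \<open>w'\<close> yields a Funk bound at \<open>p\<close>; reading that bound as
  \<open>w'\<close> varies then yields the reverse-Funk bound.\<close>

lemma detour_cost_finite:
  assumes D: "detour_cost C b g h \<le> ereal D"
  shows "S \<subseteq> T" "\<exists>l. l *\<^sub>R x - y \<in> closure C"
    "ln (Mcone C y x) + funk T p q
      \<le> D + (rfunk C b y - rfunk C b x) + (funk T b q - funk S b p)" (is "_ \<le> ?c")
proof -
  have le: "funk T w q - funk S w p \<le> ?c - (rfunk C w' y - rfunk C w' x)"
    if "w \<in> C" "w' \<in> C" for w w'
    using order_trans[OF detour_cost_split_lower[OF that] D]
    by (simp add: rfunk_horo_def funk_horo_def)
  show "S \<subseteq> T" by (rule funk_difference_bound(1)[OF oC C0 S T le[OF _ b]])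
  have "funk T p q \<le> ?c - (rfunk C w' y - rfunk C w' x)" if "w' \<in> C" for w'
    by (rule funk_difference_bound(2)[OF oC C0 S T le[OF _ that]])
  then have *: "exp (?c - funk T p q) *\<^sub>R x - y \<in> closure C"
    by (intro rfunk_difference_bound[OF C b x y]) force
  then show "\<exists>l. l *\<^sub>R x - y \<in> closure C" ..
  note Mcone_le_iff[OF oC x(1) proper_cone_uminus_notin[OF C y] *]
    Mcone_pos[OF oC x(1) proper_cone_uminus_notin[OF C y] *]
  then have "ln (Mcone C y x) \<le> ?c - funk T p q"
    using * ln_le_cancel_iff[of "Mcone C y x" "exp (?c - funk T p q)"] by simp
  then show "ln (Mcone C y x) + funk T p q \<le> ?c" by linarith
qed

lemma detour_cost_not_minus_infinity: "detour_cost C b g h \<noteq> - \<infinity>"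
  using detour_cost_split_lower[OF b b] by auto

text \<open>The upper bound combines the triangle inequalities through \<open>x\<close> and through
  \<open>p\<close>; the lower one is the finite-cost estimate. The base-point terms change sign when
  \<open>(x, p)\<close> and \<open>(y, q)\<close> are exchanged.\<close>

lemma detour_cost_eq:
  assumes ST: "S = T" and l: "l *\<^sub>R x - y \<in> closure C"
  shows "detour_cost C b g h = ereal (ln (Mcone C y x) + funk S p q
      - (rfunk C b y - rfunk C b x) - (funk S b q - funk S b p))" (is "_ = ereal ?c")
proof (rule antisym)
  have qS: "q \<in> S" using T ST by simp
  obtain T0 \<gamma> where path: "is_path C T0 \<gamma>"
    and ucc: "ucc_tendsto C (\<lambda>t. horo C b (\<gamma> t)) g (path_filter T0)"
    and lim: "((\<lambda>t. hilbert C b (\<gamma> t) + g (\<gamma> t)) \<longlongrightarrow> g b) (path_filter T0)"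
    using geodesic b by blast
  have gb: "g b = 0" by (simp add: g_def rfunk_horo_def funk_horo_def)
  show "detour_cost C b g h \<le> ereal ?c"
  proof (rule detour_cost_upper[OF path ucc lim[unfolded gb]])
    fix w assume w: "w \<in> C"
    then have cl: "w \<in> closure C" using closure_subset by auto
    note nx = proper_cone_uminus_notin[OF C x] and ny = proper_cone_uminus_notin[OF C y]
    obtain m m' where mm: "m *\<^sub>R w - x \<in> closure C" "m' *\<^sub>R w - y \<in> closure C"
      using open_cone_dominates[OF oC w] by meson
    have "Mcone C y w \<le> Mcone C y x * Mcone C x w"
      by (rule Mcone_triangle[OF oC cl x(1) ny nx l mm(1)])
    then have "rfunk C w y \<le> ln (Mcone C y x) + rfunk C w x"
      using Mcone_pos[OF oC cl nx mm(1)] Mcone_pos[OF oC cl ny mm(2)] Mcone_pos[OF oC x(1) ny l]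
      unfolding rfunk_def by (simp flip: ln_mult_pos)
    moreover have "funk S w q \<le> funk S w p + funk S p q"
    proof -
      have wS: "w \<in> S" using w oS by auto
      have "0 < Mcone S w q" "0 < Mcone S w p" "0 < Mcone S p q"
        using Mcone_pos_open[OF oS(1,2)] wS S qS by auto
      then show ?thesis
        using Mcone_triangle_open[OF oS(1,2) wS S(2) qS]
        unfolding funk_def by (simp flip: ln_mult_pos)
    qed
    ultimately show "h w - g w \<le> ?c"
      using ST by (simp add: h_def g_def rfunk_horo_def funk_horo_def)
  qed
  \<comment> \<open>The upper bound just proved excludes \<open>\<infinity>\<close>, so the
    finite-cost estimate applies with the exact value.\<close>
  then obtain D where D: "detour_cost C b g h = ereal D"
    using detour_cost_not_minus_infinity by (cases "detour_cost C b g h") auto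
  then show "ereal ?c \<le> detour_cost C b g h"
    using detour_cost_finite(3)[of D] ST by simp
qed

end

section \<open>Symmetrisation into the detour metric\<close>

theorem theorem4p7:
  fixes C S T :: "'a::euclidean_space set" and b x y p q :: 'a
  assumes "proper_cone C" and "b \<in> C"
    and "x \<in> frontier C - {0}" and "y \<in> frontier C - {0}"
    and "S \<in> cone_tangents (tangent_cone C x)" and "T \<in> cone_tangents (tangent_cone C y)"
    and "p \<in> S" and "q \<in> T"
    and "busemann C b (\<lambda>w. rfunk_horo C b x w + funk_horo S b p w)"
    and "busemann C b (\<lambda>w. rfunk_horo C b y w + funk_horo T b q w)"
  shows "detour_metric C b (\<lambda>w. rfunk_horo C b x w + funk_horo S b p w)
                           (\<lambda>w. rfunk_horo C b y w + funk_horo T b q w)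
       = (if cone_face C x = cone_face C y \<and> S = T
          then ereal (hilbert (cone_face C x) x y + hilbert S p q) else \<infinity>)"
proof -
  let ?g = "\<lambda>w. rfunk_horo C b x w + funk_horo S b p w"
  let ?h = "\<lambda>w. rfunk_horo C b y w + funk_horo T b q w"
  have oC: "open_cone C" using assms(1) by (simp add: proper_cone_def)
  have x: "x \<in> closure C" "x \<noteq> 0" "x \<in> frontier C" and y: "y \<in> closure C" "y \<noteq> 0" "y \<in> frontier C"
    using assms(3,4) by (auto simp: frontier_def)
  obtain k where S: "S \<in> (Gamma ^^ k) {C}"
    using cone_tangents_tangent_cone[OF assms(5) x(3)] .
  obtain m where T: "T \<in> (Gamma ^^ m) {C}"
    using cone_tangents_tangent_cone[OF assms(6) y(3)] .
  \<comment> \<open>The preceding estimates are asymmetric in the two Busemann points;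
    \<open>hg\<close> instantiates them with the roles exchanged.\<close>
  note gh = assms(1,2) x(1,2) y(1,2) S assms(7) T assms(8) refl refl assms(9)
  note hg = assms(1,2) y(1,2) x(1,2) T assms(8) S assms(7) refl refl assms(10)
  note face_iff = cone_face_eq_iff[OF oC x(1,2) y(1,2)]
  show ?thesis
  proof (cases "cone_face C x = cone_face C y \<and> S = T")
    case True
    then obtain l l' where l: "l *\<^sub>R x - y \<in> closure C" "l' *\<^sub>R y - x \<in> closure C"
      using face_iff by blast
    have xy: "x \<in> cone_face C x" "y \<in> cone_face C x"
      using True self_in_cone_face[OF oC x(1,2)] self_in_cone_face[OF oC y(1,2)] by auto
    show ?thesis
      using True detour_cost_eq[OF gh _ l(1)] detour_cost_eq[OF hg _ l(2)]
        Mcone_cone_face[OF oC x(1,2) xy] Mcone_cone_face[OF oC x(1,2) xy(2,1)]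
      by (simp add: detour_metric_def hilbert_def funk_def rfunk_def)
  next
    case False
    note fin = detour_cost_not_minus_infinity[OF gh] detour_cost_not_minus_infinity[OF hg]
    have "detour_cost C b ?g ?h = \<infinity> \<or> detour_cost C b ?h ?g = \<infinity>"
    proof (rule ccontr)
      \<comment> \<open>Two finite costs would give both inclusions between \<open>S\<close> and
        \<open>T\<close> and mutual domination of \<open>x\<close> and \<open>y\<close>, hence equal
        cones and equal faces.\<close>
      assume "\<not> ?thesis"
      with fin obtain D D' where "detour_cost C b ?g ?h = ereal D" "detour_cost C b ?h ?g = ereal D'"
        by (metis ereal_cases)
      with detour_cost_finite(1,2)[OF gh, of D] detour_cost_finite(1,2)[OF hg, of D'] False face_iff
      show False by auto
    qed
    with fin have "detour_metric C b ?g ?h = \<infinity>"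
      unfolding detour_metric_def by auto
    with False show ?thesis by simp
  qed
qed

end
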